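(* Assume that $(X,d)$ is a complete metric space and $f:X\to X$ is a Banach contraction with the unique fixed point $x_*$ and a Lipschitz constant $\alpha$. Let $\varepsilon>0$, let $\hat X$ be an $\varepsilon$-net of $X$, let $r:X\to\hat X$ be an $\varepsilon$-projection, and let $\hat f:=(r\circ f)_{|\hat X}$ be the $r$-discretization of $f$. Then for every $x\in\hat X$ and $n\in\mathbb N$, $$d(\hat f^{\,n}(x),x_* )\le \frac{5\varepsilon}{1-\operatorname{Lip}(f)}+\alpha^n d(x,x_* ).$$ In particular, there exists a point $y\in X$ so that $d(x_*,y)\le\frac{6\varepsilon}{1-\operatorname{Lip}(f)}$ and which can be reached as an appropriate iteration of $\hat f$ of an arbitrary point of $\hat X$.
   Context: $\operatorname{Lip}(f)$ denotes the Lipschitz constant of a map $f$ between metric spaces. A map $f:X\to X$ is a Banach contraction if $\operatorname{Lip}(f)<1$. A subset $\hat X$ of a metric space $(X,d)$ is an $\varepsilon$-net of $X$ if for every $x\in X$ there is $y\in\hat X$ with $d(x,y)\le\varepsilon$. A map $r:X\to\hat X$ is an $\varepsilon$-projection of $X$ to $\hat X$ if $r(x)=x$ for all $x\in\hat X$ and $d(x,r(x))\le\varepsilon$ for all $x\in X$. For $f:X\to X$, its $r$-discretization is the map $\hat f:=(r\circ f)_{|\hat X}:\hat X\to\hat X$, and $\hat f^{\,n}$ denotes its $n$-fold iterate.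
   Formalization: In the final claim the point y may depend on the starting point of X̂; a single y reachable from every point of X̂ fails, e.g. X=ℝ, f(x)=x/2, X̂=εℤ, r(±ε/2)=±ε, where −ε, 0, ε are all fixed by the discretization. *)

theory Defs
  imports "HOL-Analysis.Analysis"
begin

text \<open>A metric space is rendered as a subset \<open>X\<close> of a type of class \<open>metric_space\<close> with the
  induced distance; \<open>X = UNIV\<close> is the case of the whole type.\<close>

text \<open>The least Lipschitz constant of \<open>f\<close> on \<open>X\<close>. It is meaningful only if \<open>f\<close> is Lipschitz on \<open>X\<close>,
  since the infimum of the empty set of reals is unspecified. Note that
  \<open>lipschitz_on\<close> requires its constant to be nonnegative.\<close>

definition Lip :: "'a::metric_space set \<Rightarrow> ('a \<Rightarrow> 'b::metric_space) \<Rightarrow> real"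
  where "Lip X f = Inf {C. C-lipschitz_on X f}"

text \<open>The existence of some Lipschitz constant expresses that \<open>Lip X f\<close> is finite.\<close>

definition banach_contraction :: "'a::metric_space set \<Rightarrow> ('a \<Rightarrow> 'a) \<Rightarrow> bool"
  where "banach_contraction X f \<longleftrightarrow>
    f \<in> X \<rightarrow> X \<and> (\<exists>C. C-lipschitz_on X f) \<and> Lip X f < 1"

definition eps_net :: "real \<Rightarrow> 'a::metric_space set \<Rightarrow> 'a set \<Rightarrow> bool"
  where "eps_net \<epsilon> X Xhat \<longleftrightarrow> Xhat \<subseteq> X \<and> (\<forall>x\<in>X. \<exists>y\<in>Xhat. dist x y \<le> \<epsilon>)"

definition eps_projection :: "real \<Rightarrow> 'a::metric_space set \<Rightarrow> 'a set \<Rightarrow> ('a \<Rightarrow> 'a) \<Rightarrow> bool"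
  where "eps_projection \<epsilon> X Xhat r \<longleftrightarrow>
    r \<in> X \<rightarrow> Xhat \<and> (\<forall>x\<in>Xhat. r x = x) \<and> (\<forall>x\<in>X. dist x (r x) \<le> \<epsilon>)"

definition discretization :: "'a set \<Rightarrow> ('a \<Rightarrow> 'a) \<Rightarrow> ('a \<Rightarrow> 'a) \<Rightarrow> 'a \<Rightarrow> 'a"
  where "discretization Xhat r f = restrict (r \<circ> f) Xhat"

end

theory Submission
  imports Defs
begin

text \<open>Writing \<open>L\<close> for the least Lipschitz constant of \<open>f\<close>, each step of the discretization brings a
  point to distance at most \<open>L\<close> times the old one plus \<open>\<epsilon>\<close> from the fixed point, so after
  \<open>n\<close> steps the distance is at most \<open>\<epsilon> / (1 - L) + L ^ n * dist x x_star\<close>. Since \<open>L \<le> \<alpha>\<close>, this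
  gives the estimate, and the second term tends to zero.\<close>

lemma Lip_le:
  assumes "C-lipschitz_on X f"
  shows "Lip X f \<le> C"
  unfolding Lip_def
  by (rule cInf_lower) (use assms lipschitz_on_nonneg in \<open>auto intro!: bdd_belowI[where m = 0]\<close>)

text \<open>The infimum is attained: for distinct \<open>x\<close> and \<open>y\<close> the quotient
  \<open>dist (f x) (f y) / dist x y\<close> is a lower bound of all Lipschitz constants, hence of
  their infimum. The assumption makes the set of constants nonempty, without which
  \<open>Inf\<close> would be unspecified.\<close>

lemma lipschitz_on_Lip:
  assumes "C-lipschitz_on X f"
  shows "(Lip X f)-lipschitz_on X f"
proof (rule lipschitz_onI)
  have ne: "{C. C-lipschitz_on X f} \<noteq> {}"
    using assms by blast
  show "0 \<le> Lip X f"
    unfolding Lip_def using ne by (rule cInf_greatest) (auto dest: lipschitz_on_nonneg)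
  fix x y
  assume xy: "x \<in> X" "y \<in> X"
  show "dist (f x) (f y) \<le> Lip X f * dist x y"
  proof (cases "x = y")
    case False
    have "dist (f x) (f y) / dist x y \<le> Lip X f"
      unfolding Lip_def using ne
    proof (rule cInf_greatest)
      fix K
      assume "K \<in> {C. C-lipschitz_on X f}"
      then have "dist (f x) (f y) \<le> K * dist x y"
        using xy by (auto dest: lipschitz_onD)
      then show "dist (f x) (f y) / dist x y \<le> K"
        using False by (simp add: pos_divide_le_eq)
    qed
    then show ?thesis
      using False by (simp add: pos_divide_le_eq)
  qed simp
qed

lemma funpow_discretization_in:
  assumes "f \<in> X \<rightarrow> X" "r \<in> X \<rightarrow> Xhat" "Xhat \<subseteq> X" "x \<in> Xhat"
  shows "(discretization Xhat r f ^^ n) x \<in> Xhat"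
  using assms by (induction n) (auto simp: discretization_def)

text \<open>One step turns a bound \<open>t\<close> on the distance to \<open>p\<close> into
  \<open>\<epsilon> + L * t\<close>, and \<open>\<epsilon> / (1 - L)\<close> is the fixed point of
  this affine map. So the first summand reproduces itself, while the second gains a factor
  \<open>L\<close>.\<close>

lemma dist_funpow_discretization_le:
  fixes X Xhat :: "'a::metric_space set"
  assumes f: "f \<in> X \<rightarrow> X" and lip: "L-lipschitz_on X f" and "L < 1"
    and "p \<in> X" "f p = p"
    and "Xhat \<subseteq> X" and proj: "eps_projection \<epsilon> X Xhat r"
    and "x \<in> Xhat" and "\<epsilon> \<ge> 0"
  shows "dist ((discretization Xhat r f ^^ n) x) p \<le> \<epsilon> / (1 - L) + L ^ n * dist x p"
proof (induction n)
  case 0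
  show ?case
    using assms by simp
next
  case (Suc n)
  define z where "z = (discretization Xhat r f ^^ n) x"
  \<comment> \<open>Membership in \<open>Xhat\<close> is essential for unfolding the next step:
    outside \<open>Xhat\<close> the restricted map takes the value \<open>undefined\<close>.\<close>
  have z: "z \<in> Xhat"
    unfolding z_def using assms by (intro funpow_discretization_in) (auto simp: eps_projection_def)
  then have "z \<in> X" "f z \<in> X"
    using f \<open>Xhat \<subseteq> X\<close> by auto
  have "dist (f z) p \<le> L * dist z p"
    using lipschitz_onD[OF lip \<open>z \<in> X\<close> \<open>p \<in> X\<close>] \<open>f p = p\<close> by simp
  also have "\<dots> \<le> L * (\<epsilon> / (1 - L) + L ^ n * dist x p)"
    using Suc.IH lipschitz_on_nonneg[OF lip] by (simp add: z_def mult_left_mono)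
  finally have fz: "dist (f z) p \<le> L * (\<epsilon> / (1 - L) + L ^ n * dist x p)" .
  have "dist (r (f z)) p \<le> dist (f z) (r (f z)) + dist (f z) p"
    by (rule dist_triangle3)
  also have "\<dots> \<le> \<epsilon> + L * (\<epsilon> / (1 - L) + L ^ n * dist x p)"
    using proj \<open>f z \<in> X\<close> fz by (auto simp: eps_projection_def intro: add_mono)
  \<comment> \<open>This is the fixed point equation \<open>\<epsilon> + L * (\<epsilon> / (1 - L))
    = \<epsilon> / (1 - L)\<close>.\<close>
  also have "\<dots> = \<epsilon> / (1 - L) + L ^ Suc n * dist x p"
    using \<open>L < 1\<close> by (simp add: field_simps)
  finally have "dist (r (f z)) p \<le> \<epsilon> / (1 - L) + L ^ Suc n * dist x p" .
  moreover have "discretization Xhat r f z = r (f z)"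
    using z by (simp add: discretization_def)
  ultimately show ?case
    by (simp add: z_def)
qed

theorem theorem4p2:
  fixes X Xhat :: "'a::metric_space set" and f r :: "'a \<Rightarrow> 'a"
    and x_star :: 'a and \<alpha> \<epsilon> :: real
  assumes "complete X"
    and "banach_contraction X f"
    and "x_star \<in> X" and "\<forall>y\<in>X. f y = y \<longleftrightarrow> y = x_star"
    and "\<alpha>-lipschitz_on X f"
    and "\<epsilon> > 0"
    and "eps_net \<epsilon> X Xhat"
    and "eps_projection \<epsilon> X Xhat r"
  shows "(\<forall>x\<in>Xhat. \<forall>n::nat.
            dist ((discretization Xhat r f ^^ n) x) x_star
              \<le> 5 * \<epsilon> / (1 - Lip X f) + \<alpha> ^ n * dist x x_star)
       \<and> (\<forall>x\<in>Xhat. \<exists>y\<in>X.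
            dist x_star y \<le> 6 * \<epsilon> / (1 - Lip X f)
            \<and> (\<exists>n::nat. (discretization Xhat r f ^^ n) x = y))"
proof -
  define L where "L = Lip X f"
  have f: "f \<in> X \<rightarrow> X" and "L < 1"
    using assms(2) by (auto simp: banach_contraction_def L_def)
  have lip: "L-lipschitz_on X f"
    unfolding L_def using assms(5) by (rule lipschitz_on_Lip)
  have "L \<ge> 0"
    using lip by (rule lipschitz_on_nonneg)
  have "L \<le> \<alpha>"
    unfolding L_def using assms(5) by (rule Lip_le)
  have sub: "Xhat \<subseteq> X"
    using assms(7) by (simp add: eps_net_def)
  have main: "dist ((discretization Xhat r f ^^ n) x) x_star \<le> \<epsilon> / (1 - L) + L ^ n * dist x x_star"
    if "x \<in> Xhat" for x n
    using dist_funpow_discretization_le[OF f lip \<open>L < 1\<close> assms(3) _ sub assms(8) that] assms(3,4,6)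
    by simp
  \<comment> \<open>The first inequality relaxes \<open>main\<close> to the claimed constant. The
    second holds because \<open>0 < 1 - L \<le> 1\<close>; it later absorbs the remaining error into
    the multiple of \<open>\<epsilon> / (1 - L)\<close>.\<close>
  have eps: "\<epsilon> / (1 - L) \<le> 5 * \<epsilon> / (1 - L)" "5 * \<epsilon> \<le> 5 * \<epsilon> / (1 - L)"
    using \<open>L < 1\<close> \<open>L \<ge> 0\<close> \<open>\<epsilon> > 0\<close> by (auto simp: field_simps)
  show ?thesis
    unfolding L_def[symmetric]
  proof (intro conjI ballI allI)
    fix x n
    assume "x \<in> Xhat"
    have "L ^ n * dist x x_star \<le> \<alpha> ^ n * dist x x_star"
      using \<open>L \<ge> 0\<close> \<open>L \<le> \<alpha>\<close> by (intro mult_right_mono power_mono) auto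
    then show "dist ((discretization Xhat r f ^^ n) x) x_star
        \<le> 5 * \<epsilon> / (1 - L) + \<alpha> ^ n * dist x x_star"
      using main[OF \<open>x \<in> Xhat\<close>, of n] eps(1) by linarith
  next
    fix x
    assume x: "x \<in> Xhat"
    \<comment> \<open>The decay is that of the powers of \<open>L\<close>, not of
      \<open>\<alpha>\<close>: the constant \<open>\<alpha>\<close> may be 1 or larger.\<close>
    have "(\<lambda>n. L ^ n * dist x x_star) \<longlonglongrightarrow> 0"
      using \<open>L \<ge> 0\<close> \<open>L < 1\<close> by (intro tendsto_mult_left_zero LIMSEQ_realpow_zero)
    then have "\<forall>\<^sub>F n in sequentially. L ^ n * dist x x_star < 5 * \<epsilon>"
      using \<open>\<epsilon> > 0\<close> by (intro order_tendstoD(2)) auto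
    \<comment> \<open>The threshold \<open>5 * \<epsilon>\<close> is what remains of
      \<open>6 * \<epsilon> / (1 - L)\<close> after the term \<open>\<epsilon> / (1 - L)\<close> of
      \<open>main\<close>, by the second part of \<open>eps\<close>. The index \<open>n\<close>, and
      with it the point reached, may depend on \<open>x\<close>.\<close>
    then obtain n where n: "L ^ n * dist x x_star < 5 * \<epsilon>"
      using eventually_happens'[OF sequentially_bot] by blast
    let ?y = "(discretization Xhat r f ^^ n) x"
    have "?y \<in> X"
      using funpow_discretization_in[OF f _ sub x] assms(8) sub
      by (auto simp: eps_projection_def)
    moreover have "dist x_star ?y \<le> 6 * \<epsilon> / (1 - L)"
    proof -
      have "dist x_star ?y \<le> \<epsilon> / (1 - L) + 5 * \<epsilon> / (1 - L)"
        using main[OF x, of n] n eps(2) by (simp add: dist_commute)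
      also have "\<dots> = 6 * \<epsilon> / (1 - L)"
        by (simp add: add_divide_distrib[symmetric])
      finally show ?thesis .
    qed
    ultimately show "\<exists>y\<in>X. dist x_star y \<le> 6 * \<epsilon> / (1 - L)
        \<and> (\<exists>n. (discretization Xhat r f ^^ n) x = y)"
      by blast
  qed
qed

end
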